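(* Let $f:\mathbb{R}^d\to\mathbb{R}$ be an $L$-smooth (not necessarily convex) function with $L>0$ and $f_*=\inf_{\mathbf{x}}f(\mathbf{x})>-\infty$, and let $\mathcal{G}(\mathbf{x};\xi)$ be a stochastic gradient of $f$. Suppose that for every $\mathbf{x}\in\mathbb{R}^d$ we have $\mathrm{E}[\|\mathcal{G}(\mathbf{x};\xi)-\nabla f(\mathbf{x})\|^2]\le\sigma^2$ and $\|\nabla f(\mathbf{x})\|\le G$. Let $\beta\in[0,1)$, $s\ge0$, $C>0$, let $t\ge0$ be an integer, and let $\{\mathbf{x}_k\}$ be generated by the stochastic unified momentum (SUM) method started at $\mathbf{x}_0$ with parameters $\beta$, $s$ and step size $\alpha=\min\left\{\frac{1-\beta}{2L[1+((1-\beta)s-1)^2]},\frac{C}{\sqrt{t+1}}\right\}$. Then $$\min_{k=0,\ldots,t}\mathrm{E}[\|\nabla f(\mathbf{x}_k)\|^2]\le\frac{2(f(\mathbf{x}_0)-f_* )(1-\beta)}{t+1}\max\left\{\frac{2L[1+((1-\beta)s-1)^2]}{1-\beta},\frac{\sqrt{t+1}}{C}\right\}+\frac{C}{\sqrt{t+1}}\cdot\frac{L\beta^2(G^2+\sigma^2)+L\sigma^2(1-\beta)^2}{(1-\beta)^3}.$$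
   Context: $\|\cdot\|$ is the Euclidean norm. $f$ is $L$-smooth if it is differentiable and $\|\nabla f(\mathbf{y})-\nabla f(\mathbf{x})\|\le L\|\mathbf{y}-\mathbf{x}\|$ for all $\mathbf{x},\mathbf{y}\in\mathbb{R}^d$. Stochastic gradient: $\xi_0,\xi_1,\dots$ are independent random variables distributed as $\xi$, and $\mathrm{E}_{\xi}[\mathcal{G}(\mathbf{x};\xi)]=\nabla f(\mathbf{x})$ for every $\mathbf{x}$ (so, conditionally on $\xi_0,\dots,\xi_{k-1}$, the expectation of $\mathcal{G}(\mathbf{x}_k;\xi_k)$ is $\nabla f(\mathbf{x}_k)$). SUM method with parameters $\alpha>0$, $\beta\in[0,1)$, $s\ge0$: given a deterministic $\mathbf{x}_0\in\mathbb{R}^d$, set $\mathbf{y}^s_0=\mathbf{x}_0$, and for $k=0,1,2,\dots$, with $\mathcal{G}_k=\mathcal{G}(\mathbf{x}_k;\xi_k)$, $$\mathbf{y}_{k+1}=\mathbf{x}_k-\alpha\mathcal{G}_k,\qquad \mathbf{y}^s_{k+1}=\mathbf{x}_k-s\alpha\mathcal{G}_k,\qquad \mathbf{x}_{k+1}=\mathbf{y}_{k+1}+\beta(\mathbf{y}^s_{k+1}-\mathbf{y}^s_k).$$ *)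

theory Defs
  imports "HOL-Probability.Probability"
begin

definition gradient :: "('a::euclidean_space \<Rightarrow> real) \<Rightarrow> 'a \<Rightarrow> 'a" where
  "gradient f x = (THE D. GDERIV f x :> D)"

definition L_smooth :: "real \<Rightarrow> ('a::euclidean_space \<Rightarrow> real) \<Rightarrow> bool" where
  "L_smooth L f \<longleftrightarrow>
     (\<forall>x. f differentiable (at x)) \<and>
     (\<forall>x y. norm (gradient f y - gradient f x) \<le> L * norm (y - x))"

text \<open>
  The measure \<open>D\<close> is the law of the random variable \<open>\<xi>\<close>. Joint measurability of the oracle makes
  its value at a random query point a random variable; integrability is stated explicitly because
  the Bochner integral of a non-integrable function is \<open>0\<close> by convention.
\<close>

definition stochastic_gradient ::
  "'b measure \<Rightarrow> ('a::euclidean_space \<Rightarrow> 'b \<Rightarrow> 'a) \<Rightarrow> ('a \<Rightarrow> real) \<Rightarrow> bool" where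
  "stochastic_gradient D \<G> f \<longleftrightarrow>
     (\<lambda>(x, z). \<G> x z) \<in> borel_measurable (borel \<Otimes>\<^sub>M D) \<and>
     (\<forall>x. integrable D (\<G> x) \<and> (LINT z|D. \<G> x z) = gradient f x)"

text \<open>
  State \<open>(x\<^sub>k, y\<^sup>s\<^sub>k)\<close> of the unified momentum method along a single sample path
  \<open>\<zeta> 0, \<zeta> 1, \<dots>\<close> of the random inputs.
\<close>

primrec SUM_state ::
  "real \<Rightarrow> real \<Rightarrow> real \<Rightarrow> ('a::euclidean_space \<Rightarrow> 'b \<Rightarrow> 'a) \<Rightarrow> 'a \<Rightarrow> (nat \<Rightarrow> 'b) \<Rightarrow> nat \<Rightarrow> 'a \<times> 'a" where
  "SUM_state \<alpha> \<beta> s \<G> x0 \<zeta> 0 = (x0, x0)"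
| "SUM_state \<alpha> \<beta> s \<G> x0 \<zeta> (Suc k) =
     (let (x, ys) = SUM_state \<alpha> \<beta> s \<G> x0 \<zeta> k;
          g = \<G> x (\<zeta> k);
          y' = x - \<alpha> *\<^sub>R g;
          ys' = x - (s * \<alpha>) *\<^sub>R g
      in (y' + \<beta> *\<^sub>R (ys' - ys), ys'))"

definition SUM_iterate ::
  "real \<Rightarrow> real \<Rightarrow> real \<Rightarrow> ('a::euclidean_space \<Rightarrow> 'b \<Rightarrow> 'a) \<Rightarrow> 'a \<Rightarrow> (nat \<Rightarrow> 'b) \<Rightarrow> nat \<Rightarrow> 'a" where
  "SUM_iterate \<alpha> \<beta> s \<G> x0 \<zeta> k = fst (SUM_state \<alpha> \<beta> s \<G> x0 \<zeta> k)"

end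

(*
  With eta = alpha / (1 - beta), the shadow sequence z = x + beta / (1 - beta) * (x - y^s) performs
  plain stochastic gradient steps z' = z - eta * g, where g is sampled at x rather than at z. The lag
  z - x is (1 - beta) * s - 1 times a discounted sum of past stochastic gradients, whose second
  moment is at most a multiple of G^2 + sigma^2. The smoothness inequality along z therefore gives an
  expected decrease of f by eta / 2 * E |grad f (x_k)|^2 up to a constant error, and telescoping
  bounds the average, hence the minimum, of these gradient norms.
*)

theory Submission
  imports Defs
begin

section \<open>Gradients and the smoothness inequality\<close>

lemma GDERIV_unique:
  assumes "GDERIV f x :> D" "GDERIV f x :> E"
  shows "D = E"
proof -
  have "(\<lambda>h. inner h D) = (\<lambda>h. inner h E)"
    using assms unfolding gderiv_def by (rule has_derivative_unique)
  then have "inner (D - E) (D - E) = 0"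
    unfolding inner_diff_right by (metis diff_self)
  then show ?thesis
    by simp
qed

text \<open>The derivative is a linear functional, so on a Euclidean space it is represented by the
  vector \<open>adjoint f' 1\<close>. Uniqueness of that vector makes the \<open>THE\<close> in
  \<open>gradient\<close> denote it.\<close>

lemma GDERIV_gradient:
  fixes f :: "'a::euclidean_space \<Rightarrow> real"
  assumes "f differentiable (at x)"
  shows "GDERIV f x :> gradient f x"
proof -
  obtain f' where f': "(f has_derivative f') (at x)"
    using assms unfolding differentiable_def by blast
  then have "linear f'"
    by (rule has_derivative_linear)
  then have "f' = (\<lambda>h. inner h (adjoint f' 1))"
    by (simp add: fun_eq_iff adjoint_works)
  with f' have "GDERIV f x :> adjoint f' 1"
    unfolding gderiv_def by metis
  then show ?thesis
    unfolding gradient_def by (rule theI) (use \<open>GDERIV f x :> adjoint f' 1\<close> GDERIV_unique in blast)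
qed

text \<open>On the segment from \<open>x\<close> to \<open>y\<close>, the difference between
  \<open>f\<close> and its quadratic model has nonpositive derivative, by Cauchy-Schwarz and the
  Lipschitz bound. Monotonicity then replaces integration of the gradient.\<close>

lemma L_smooth_descent:
  fixes f :: "'a::euclidean_space \<Rightarrow> real"
  assumes "L_smooth L f"
  shows "f y \<le> f x + inner (gradient f x) (y - x) + L / 2 * (norm (y - x))\<^sup>2"
proof -
  define d where "d = y - x"
  define \<phi> where "\<phi> = (\<lambda>t. f (x + t *\<^sub>R d) - t * inner (gradient f x) d - L / 2 * t\<^sup>2 * (norm d)\<^sup>2)"
  have "\<phi> 1 \<le> \<phi> 0"
  proof (rule DERIV_nonpos_imp_nonincreasing[where f = \<phi>])
    fix t :: real
    assume "0 \<le> t"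
    have "(f has_derivative (\<lambda>h. inner h (gradient f (x + t *\<^sub>R d)))) (at (x + t *\<^sub>R d))"
      using assms GDERIV_gradient unfolding L_smooth_def gderiv_def by blast
    then have "((\<lambda>t. f (x + t *\<^sub>R d)) has_derivative (\<lambda>h. inner (h *\<^sub>R d) (gradient f (x + t *\<^sub>R d)))) (at t)"
      by (rule has_derivative_compose[rotated]) (auto intro!: derivative_eq_intros)
    then have "((\<lambda>t. f (x + t *\<^sub>R d)) has_real_derivative inner (gradient f (x + t *\<^sub>R d)) d) (at t)"
      by (simp add: has_field_derivative_def inner_commute mult_commute_abs)
    then have "(\<phi> has_real_derivative
        inner (gradient f (x + t *\<^sub>R d) - gradient f x) d - L * t * (norm d)\<^sup>2) (at t)"
      unfolding \<phi>_def by (auto intro!: derivative_eq_intros simp: inner_diff_left)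
    moreover have "inner (gradient f (x + t *\<^sub>R d) - gradient f x) d \<le> L * t * (norm d)\<^sup>2"
    proof -
      have "inner (gradient f (x + t *\<^sub>R d) - gradient f x) d
          \<le> norm (gradient f (x + t *\<^sub>R d) - gradient f x) * norm d"
        by (rule norm_cauchy_schwarz)
      also have "\<dots> \<le> (L * norm ((x + t *\<^sub>R d) - x)) * norm d"
        using assms unfolding L_smooth_def by (intro mult_right_mono) (blast, simp)
      finally show ?thesis
        using \<open>0 \<le> t\<close> by (simp add: power2_eq_square mult.assoc)
    qed
    ultimately show "\<exists>D. DERIV \<phi> t :> D \<and> D \<le> 0"
      by (intro exI conjI) auto
  qed simp
  then show ?thesis
    by (simp add: \<phi>_def d_def)
qed

lemma L_smooth_measurable:
  fixes f :: "'a::euclidean_space \<Rightarrow> real"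
  assumes "L_smooth L f"
  shows "f \<in> borel_measurable borel" "gradient f \<in> borel_measurable borel"
proof -
  have "continuous_on UNIV f"
    using assms unfolding L_smooth_def
    by (intro continuous_at_imp_continuous_on ballI differentiable_imp_continuous_within) auto
  then show "f \<in> borel_measurable borel"
    by (rule borel_measurable_continuous_onI)
  \<comment> \<open>\<open>lipschitz_on\<close> demands a nonnegative constant, and the sign of
    \<open>L\<close> is open here.\<close>
  have "dist (gradient f x) (gradient f y) \<le> max L 0 * dist x y" for x y
  proof -
    have "dist (gradient f x) (gradient f y) \<le> L * dist x y"
      using assms by (simp add: L_smooth_def dist_norm)
    also have "\<dots> \<le> max L 0 * dist x y"
      by (intro mult_right_mono) auto
    finally show ?thesis .
  qed
  then have "(max L 0)-lipschitz_on UNIV (gradient f)"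
    by (intro lipschitz_onI) auto
  then show "gradient f \<in> borel_measurable borel"
    by (intro borel_measurable_continuous_onI lipschitz_on_continuous_on)
qed

text \<open>
  Weighting Young's inequality by \<open>L * c\<^sup>2\<close> cancels the factor \<open>c\<close> of the lag \<open>z - x\<close>; this is what
  the term \<open>c\<^sup>2\<close> in the step size restriction pays for.
\<close>

lemma lagged_gradient_descent:
  fixes f :: "'a::euclidean_space \<Rightarrow> real"
  assumes smooth: "L_smooth L f" and "L \<ge> 0" and "\<eta> \<ge> 0" and step: "L * \<eta> * (1 + c\<^sup>2) \<le> 1"
    and lag: "z - x = c *\<^sub>R r"
  shows "f (z - \<eta> *\<^sub>R (gradient f x + n)) \<le>
     f z - \<eta> / 2 * (norm (gradient f x))\<^sup>2 + L / 2 * (norm r)\<^sup>2 + L * \<eta>\<^sup>2 / 2 * (norm n)\<^sup>2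
       + inner ((L * \<eta>\<^sup>2) *\<^sub>R gradient f x - \<eta> *\<^sub>R gradient f z) n"
proof -
  let ?g = "gradient f x" and ?h = "gradient f z"
  have smooth_bound: "f (z - \<eta> *\<^sub>R (?g + n)) \<le> f z - \<eta> * inner ?h (?g + n) + L * \<eta>\<^sup>2 / 2 * (norm (?g + n))\<^sup>2"
    using L_smooth_descent[OF smooth, of "z - \<eta> *\<^sub>R (?g + n)" z] by (simp add: power_mult_distrib)
  \<comment> \<open>Write \<open>?h\<close> as \<open>?g + (?h - ?g)\<close> in its product with
    \<open>?g\<close>, and collect everything linear in \<open>n\<close> in one inner product, the
    term that will vanish in expectation.\<close>
  have expand: "f z - \<eta> * inner ?h (?g + n) + L * \<eta>\<^sup>2 / 2 * (norm (?g + n))\<^sup>2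
      = f z - \<eta> * inner (?h - ?g) ?g - (\<eta> - L * \<eta>\<^sup>2 / 2) * (norm ?g)\<^sup>2
      + L * \<eta>\<^sup>2 / 2 * (norm n)\<^sup>2 + inner ((L * \<eta>\<^sup>2) *\<^sub>R ?g - \<eta> *\<^sub>R ?h) n"
    unfolding power2_norm_eq_inner
    by (simp add: inner_add_left inner_add_right inner_diff_left inner_commute[of n ?g] algebra_simps)
  have young: "- \<eta> * inner (?h - ?g) ?g \<le> L / 2 * (norm r)\<^sup>2 + L / 2 * (\<eta> * \<bar>c\<bar> * norm ?g)\<^sup>2"
  proof -
    have "- \<eta> * inner (?h - ?g) ?g \<le> \<eta> * (norm (?h - ?g) * norm ?g)"
      using \<open>\<eta> \<ge> 0\<close> Cauchy_Schwarz_ineq2[of "?h - ?g" ?g]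
      by (simp only: mult_minus_left flip: mult_minus_right) (intro mult_left_mono; linarith)
    also have "\<dots> \<le> \<eta> * ((L * norm (z - x)) * norm ?g)"
      using smooth \<open>\<eta> \<ge> 0\<close> unfolding L_smooth_def by (intro mult_left_mono mult_right_mono) auto
    also have "\<dots> = L * (norm r * (\<eta> * \<bar>c\<bar> * norm ?g))"
      by (simp add: lag)
    also have "\<dots> \<le> L * (((norm r)\<^sup>2 + (\<eta> * \<bar>c\<bar> * norm ?g)\<^sup>2) / 2)"
      using sum_squares_bound[of "norm r" "\<eta> * \<bar>c\<bar> * norm ?g"] \<open>L \<ge> 0\<close>
      by (intro mult_left_mono) auto
    finally show ?thesis
      by (simp add: algebra_simps)
  qed
  \<comment> \<open>The step restriction pays for the quadratic term and the lag together, so that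
    \<open>\<eta> / 2\<close> of the decrease survives.\<close>
  have absorb: "L / 2 * (\<eta> * \<bar>c\<bar> * norm ?g)\<^sup>2 \<le> (\<eta> / 2 - L * \<eta>\<^sup>2 / 2) * (norm ?g)\<^sup>2"
  proof -
    have "L / 2 * (\<eta> * \<bar>c\<bar> * norm ?g)\<^sup>2 = (\<eta> / 2 * (L * \<eta> * (1 + c\<^sup>2)) - L * \<eta>\<^sup>2 / 2) * (norm ?g)\<^sup>2"
      by (simp add: power_mult_distrib power2_eq_square algebra_simps)
    also have "\<dots> \<le> (\<eta> / 2 * 1 - L * \<eta>\<^sup>2 / 2) * (norm ?g)\<^sup>2"
      using step \<open>\<eta> \<ge> 0\<close> by (intro mult_right_mono diff_right_mono mult_left_mono) auto
    finally show ?thesis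
      by simp
  qed
  show ?thesis
    using smooth_bound young absorb unfolding expand by (simp add: left_diff_distrib)
qed

text \<open>Convexity of the squared norm with weights \<open>\<beta>\<close> and
  \<open>1 - \<beta>\<close>, applied to \<open>m\<close> and the rescaled vector
  \<open>g / (1 - \<beta>)\<close>.\<close>

lemma norm_square_discounted_add:
  fixes m g :: "'a::real_inner"
  assumes "0 \<le> \<beta>" "\<beta> < 1"
  shows "(norm (\<beta> *\<^sub>R m + g))\<^sup>2 \<le> \<beta> * (norm m)\<^sup>2 + (norm g)\<^sup>2 / (1 - \<beta>)"
proof -
  define h where "h = g /\<^sub>R (1 - \<beta>)"
  have g: "g = (1 - \<beta>) *\<^sub>R h"
    using assms by (simp add: h_def)
  \<comment> \<open>The convexity defect of the squared norm is an exact square.\<close>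
  have "\<beta> * (norm m)\<^sup>2 + (1 - \<beta>) * (norm h)\<^sup>2 - (norm (\<beta> *\<^sub>R m + (1 - \<beta>) *\<^sub>R h))\<^sup>2
      = \<beta> * (1 - \<beta>) * (norm (m - h))\<^sup>2"
    unfolding power2_norm_eq_inner
    by (simp add: inner_add_left inner_add_right inner_diff_left inner_diff_right
        inner_commute[of h m] algebra_simps)
  also have "\<dots> \<ge> 0"
    using assms by simp
  finally have "(norm (\<beta> *\<^sub>R m + (1 - \<beta>) *\<^sub>R h))\<^sup>2 \<le> \<beta> * (norm m)\<^sup>2 + (1 - \<beta>) * (norm h)\<^sup>2"
    by simp
  also have "(1 - \<beta>) * (norm h)\<^sup>2 = (norm g)\<^sup>2 / (1 - \<beta>)"
    using assms by (simp add: g power2_eq_square)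
  finally show ?thesis
    by (simp add: g)
qed

section \<open>Independence of the past and the current sample\<close>

text \<open>Disjoint blocks of an independent family are independent, and this survives applying
  \<open>H\<close> to the past block and evaluation at \<open>k\<close> to the singleton
  block.\<close>

lemma (in prob_space) distr_pair_past_present:
  fixes \<xi> :: "nat \<Rightarrow> 'a \<Rightarrow> 'b"
  assumes indep: "indep_vars (\<lambda>_. D) \<xi> UNIV" and H[measurable]: "H \<in> measurable (PiM {..<k} (\<lambda>_. D)) N"
  defines "S \<equiv> \<lambda>\<omega>. H (restrict (\<lambda>i. \<xi> i \<omega>) {..<k})"
  shows "distr M (N \<Otimes>\<^sub>M D) (\<lambda>\<omega>. (S \<omega>, \<xi> k \<omega>)) = distr M N S \<Otimes>\<^sub>M distr M D (\<xi> k)"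
proof -
  let ?P = "PiM {..<k} (\<lambda>_. D)" and ?Q = "PiM {k} (\<lambda>_. D)"
  let ?past = "\<lambda>\<omega>. restrict (\<lambda>i. \<xi> i \<omega>) {..<k}" and ?now = "\<lambda>\<omega>. restrict (\<lambda>i. \<xi> i \<omega>) {k}"
  have "indep_var ?P ?past ?Q ?now"
    using indep by (rule indep_var_restrict) auto
  then have past[measurable]: "?past \<in> measurable M ?P" and now[measurable]: "?now \<in> measurable M ?Q"
    and joint: "distr M ?P ?past \<Otimes>\<^sub>M distr M ?Q ?now = distr M (?P \<Otimes>\<^sub>M ?Q) (\<lambda>\<omega>. (?past \<omega>, ?now \<omega>))"
    unfolding indep_var_distribution_eq by auto
  have xi[measurable]: "\<xi> k \<in> measurable M D"
    using indep by (simp add: indep_vars_def)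
  have ev[measurable]: "(\<lambda>\<zeta>. \<zeta> k) \<in> measurable ?Q D"
    by (rule measurable_component_singleton) simp
  have S: "distr (distr M ?P ?past) N H = distr M N S"
    unfolding S_def by (subst distr_distr) (auto simp: o_def)
  have Z: "distr (distr M ?Q ?now) D (\<lambda>\<zeta>. \<zeta> k) = distr M D (\<xi> k)"
    by (subst distr_distr) (auto simp: o_def)
  \<comment> \<open>\<open>pair_measure_distr\<close> asks for a sigma-finite second image
    measure.\<close>
  interpret Z: prob_space "distr M D (\<xi> k)"
    by (rule prob_space_distr) measurable
  have "distr M N S \<Otimes>\<^sub>M distr M D (\<xi> k)
      = distr (distr M ?P ?past \<Otimes>\<^sub>M distr M ?Q ?now) (N \<Otimes>\<^sub>M D) (\<lambda>(a, b). (H a, b k))"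
    unfolding S[symmetric] Z[symmetric]
    by (rule pair_measure_distr) (auto simp: Z Z.sigma_finite_measure_axioms)
  also have "\<dots> = distr M (N \<Otimes>\<^sub>M D) (\<lambda>\<omega>. (S \<omega>, \<xi> k \<omega>))"
    unfolding joint by (subst distr_distr) (auto simp: o_def S_def)
  finally show ?thesis ..
qed

text \<open>
  Independence enters through the joint law because \<open>indep_var\<close> forces both variables to have
  the same type.
\<close>

lemma (in prob_space) indep_noise:
  fixes w :: "'s \<Rightarrow> 'b \<Rightarrow> 'v::euclidean_space"
  assumes S[measurable]: "S \<in> measurable M N" and Z[measurable]: "Z \<in> measurable M D"
    and law: "distr M D Z = D"
    and joint: "distr M (N \<Otimes>\<^sub>M D) (\<lambda>\<omega>. (S \<omega>, Z \<omega>)) = distr M N S \<Otimes>\<^sub>M D"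
    and w: "(\<lambda>(s, z). w s z) \<in> borel_measurable (N \<Otimes>\<^sub>M D)"
    and mean: "\<And>s. s \<in> space N \<Longrightarrow> (LINT z|D. w s z) = 0"
    and int: "\<And>s. s \<in> space N \<Longrightarrow> integrable D (w s)"
    and sq: "\<And>s. s \<in> space N \<Longrightarrow> integrable D (\<lambda>z. (norm (w s z))\<^sup>2)"
    and var: "\<And>s. s \<in> space N \<Longrightarrow> (LINT z|D. (norm (w s z))\<^sup>2) \<le> v"
  shows integrable_norm_square_noise: "integrable M (\<lambda>\<omega>. (norm (w (S \<omega>) (Z \<omega>)))\<^sup>2)"
    and expectation_norm_square_noise: "expectation (\<lambda>\<omega>. (norm (w (S \<omega>) (Z \<omega>)))\<^sup>2) \<le> v"
    and integrable_inner_noise: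
      "\<lbrakk>h \<in> borel_measurable N; \<And>s. s \<in> space N \<Longrightarrow> norm (h s) \<le> B\<rbrakk>
        \<Longrightarrow> integrable M (\<lambda>\<omega>. inner (h (S \<omega>)) (w (S \<omega>) (Z \<omega>)))"
    and expectation_inner_noise:
      "\<lbrakk>h \<in> borel_measurable N; \<And>s. s \<in> space N \<Longrightarrow> norm (h s) \<le> B\<rbrakk>
        \<Longrightarrow> expectation (\<lambda>\<omega>. inner (h (S \<omega>)) (w (S \<omega>) (Z \<omega>))) = 0"
proof -
  define P where "P = distr M N S"
  have [simp, measurable_cong]: "sets P = sets N" and [simp]: "space P = space N"
    by (simp_all add: P_def)
  note w[measurable]
  interpret P: prob_space P
    unfolding P_def by (rule prob_space_distr) measurable
  interpret D: prob_space D
    using prob_space_distr[OF Z] law by simp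
  interpret PD: pair_prob_space P D ..
  have joint: "distr M (N \<Otimes>\<^sub>M D) (\<lambda>\<omega>. (S \<omega>, Z \<omega>)) = P \<Otimes>\<^sub>M D"
    unfolding P_def by (rule joint)
  have w_sq: "(\<integral>\<^sup>+ z. ennreal ((norm (w s z))\<^sup>2) \<partial>D) \<le> ennreal v" if "s \<in> space N" for s
    using that by (subst nn_integral_eq_integral) (auto intro!: sq ennreal_leI var)
  \<comment> \<open>Integrability over \<open>M\<close> is not yet known, so the variance bound is
    first integrated over the state by Tonelli; finiteness then yields integrability.\<close>
  have "(\<integral>\<^sup>+ \<omega>. ennreal ((norm (w (S \<omega>) (Z \<omega>)))\<^sup>2) \<partial>M)
      = (\<integral>\<^sup>+ x. ennreal ((norm (case_prod w x))\<^sup>2) \<partial>(P \<Otimes>\<^sub>M D))"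
    by (subst joint[symmetric], subst nn_integral_distr) auto
  also have "\<dots> = (\<integral>\<^sup>+ s. \<integral>\<^sup>+ z. ennreal ((norm (w s z))\<^sup>2) \<partial>D \<partial>P)"
    by (subst D.nn_integral_fst[symmetric]) auto
  also have "\<dots> \<le> (\<integral>\<^sup>+ s. ennreal v \<partial>P)"
    by (intro nn_integral_mono w_sq) simp
  also have "\<dots> = ennreal v"
    by (simp add: P.emeasure_space_1[simplified])
  finally have nn: "(\<integral>\<^sup>+ \<omega>. ennreal ((norm (w (S \<omega>) (Z \<omega>)))\<^sup>2) \<partial>M) \<le> ennreal v" .
  have [measurable]: "(\<lambda>\<omega>. w (S \<omega>) (Z \<omega>)) \<in> borel_measurable M"
    using measurable_compose[OF measurable_Pair[OF S Z] w] by simp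
  show sq_M: "integrable M (\<lambda>\<omega>. (norm (w (S \<omega>) (Z \<omega>)))\<^sup>2)"
    using nn by (intro integrableI_bounded) (auto simp: top.not_eq_extremum intro: le_less_trans)
  \<comment> \<open>\<open>ennreal\<close> sends negative reals to 0, so returning to a real
    inequality requires the sign of \<open>v\<close>.\<close>
  have "0 \<le> v"
  proof -
    obtain s where "s \<in> space N"
      using P.not_empty by auto
    moreover have "0 \<le> (LINT z|D. (norm (w s z))\<^sup>2)"
      by simp
    ultimately show ?thesis
      using var by (blast intro: order_trans)
  qed
  then show "expectation (\<lambda>\<omega>. (norm (w (S \<omega>) (Z \<omega>)))\<^sup>2) \<le> v"
    using nn sq_M by (subst (asm) nn_integral_eq_integral) (auto simp: ennreal_le_iff)
  have w_M: "integrable M (\<lambda>\<omega>. norm (w (S \<omega>) (Z \<omega>)))"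
    using sq_M by (rule square_integrable_imp_integrable[rotated]) simp
  assume h[measurable]: "h \<in> borel_measurable N" and B: "\<And>s. s \<in> space N \<Longrightarrow> norm (h s) \<le> B"
  have inner_M: "integrable M (\<lambda>\<omega>. inner (h (S \<omega>)) (w (S \<omega>) (Z \<omega>)))"
  proof (rule Bochner_Integration.integrable_bound)
    show "integrable M (\<lambda>\<omega>. B * norm (w (S \<omega>) (Z \<omega>)))"
      using w_M by simp
    have "norm (inner (h (S \<omega>)) (w (S \<omega>) (Z \<omega>))) \<le> norm (B * norm (w (S \<omega>) (Z \<omega>)))"
      if "\<omega> \<in> space M" for \<omega>
    proof -
      have "norm (inner (h (S \<omega>)) (w (S \<omega>) (Z \<omega>))) \<le> norm (h (S \<omega>)) * norm (w (S \<omega>) (Z \<omega>))"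
        by (simp add: Cauchy_Schwarz_ineq2)
      also have "\<dots> \<le> B * norm (w (S \<omega>) (Z \<omega>))"
        using B measurable_space[OF S that] by (intro mult_right_mono) auto
      finally show ?thesis
        by simp
    qed
    then show "AE \<omega> in M. norm (inner (h (S \<omega>)) (w (S \<omega>) (Z \<omega>))) \<le> norm (B * norm (w (S \<omega>) (Z \<omega>)))"
      by simp
  qed measurable
  then show "integrable M (\<lambda>\<omega>. inner (h (S \<omega>)) (w (S \<omega>) (Z \<omega>)))" .
  have inner_PD: "integrable (P \<Otimes>\<^sub>M D) (\<lambda>(s, z). inner (h s) (w s z))"
    using inner_M by (subst joint[symmetric], subst integrable_distr_eq) auto
  \<comment> \<open>Fubini under the product law: for a fixed state, \<open>h s\<close> leaves the
    inner integral, which is 0 by \<open>mean\<close>.\<close>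
  have "expectation (\<lambda>\<omega>. inner (h (S \<omega>)) (w (S \<omega>) (Z \<omega>)))
      = (LINT x|(P \<Otimes>\<^sub>M D). (\<lambda>(s, z). inner (h s) (w s z)) x)"
    by (subst joint[symmetric], subst integral_distr) auto
  also have "\<dots> = (LINT s|P. LINT z|D. inner (h s) (w s z))"
    using PD.integral_fst'[OF inner_PD] by simp
  also have "\<dots> = (LINT s|P. 0)"
    by (intro Bochner_Integration.integral_cong) (simp_all add: int mean)
  finally show "expectation (\<lambda>\<omega>. inner (h (S \<omega>)) (w (S \<omega>) (Z \<omega>))) = 0"
    by simp
qed


section \<open>The state as a function of the samples\<close>

text \<open>Projections in place of the tuple pattern suit rewriting and measurability
  proofs.\<close>

lemma SUM_state_Suc:
  "SUM_state \<alpha> \<beta> s \<G> x0 \<zeta> (Suc k) =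
    (let p = SUM_state \<alpha> \<beta> s \<G> x0 \<zeta> k; g = \<G> (fst p) (\<zeta> k)
     in ((fst p - \<alpha> *\<^sub>R g) + \<beta> *\<^sub>R ((fst p - (s * \<alpha>) *\<^sub>R g) - snd p), fst p - (s * \<alpha>) *\<^sub>R g))"
  by (simp add: Let_def case_prod_beta)

text \<open>This is adaptedness: through it the state becomes a function of the past alone, hence
  independent of the sample used next.\<close>

lemma SUM_state_cong:
  "(\<And>i. i < k \<Longrightarrow> \<zeta> i = \<zeta>' i) \<Longrightarrow> SUM_state \<alpha> \<beta> s \<G> x0 \<zeta> k = SUM_state \<alpha> \<beta> s \<G> x0 \<zeta>' k"
  by (induction k) (simp_all add: SUM_state_Suc del: SUM_state.simps(2))

text \<open>The index set \<open>{..<n}\<close> stays fixed while \<open>k\<close> grows in the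
  induction; \<open>Suc k \<le> n\<close> makes coordinate \<open>k\<close> available.\<close>

lemma SUM_state_measurable:
  fixes \<G> :: "'a::euclidean_space \<Rightarrow> 'b \<Rightarrow> 'a"
  assumes G: "(\<lambda>(x, z). \<G> x z) \<in> borel_measurable (borel \<Otimes>\<^sub>M D)" and "k \<le> n"
  shows "(\<lambda>\<zeta>. SUM_state \<alpha> \<beta> s \<G> x0 \<zeta> k) \<in> measurable (PiM {..<n} (\<lambda>_. D)) (borel \<Otimes>\<^sub>M borel)"
  using \<open>k \<le> n\<close>
proof (induction k)
  case 0
  show ?case
    by simp
next
  case (Suc k)
  then have IH[measurable]:
    "(\<lambda>\<zeta>. SUM_state \<alpha> \<beta> s \<G> x0 \<zeta> k) \<in> measurable (PiM {..<n} (\<lambda>_. D)) (borel \<Otimes>\<^sub>M borel)"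
    by simp
  have [measurable]: "(\<lambda>\<zeta>. \<zeta> k) \<in> measurable (PiM {..<n} (\<lambda>_. D)) D"
    using Suc.prems by (intro measurable_component_singleton) simp
  have "(\<lambda>\<zeta>. (fst (SUM_state \<alpha> \<beta> s \<G> x0 \<zeta> k), \<zeta> k)) \<in> measurable (PiM {..<n} (\<lambda>_. D)) (borel \<Otimes>\<^sub>M D)"
    by measurable
  from measurable_compose[OF this G]
  have [measurable]: "(\<lambda>\<zeta>. \<G> (fst (SUM_state \<alpha> \<beta> s \<G> x0 \<zeta> k)) (\<zeta> k)) \<in> borel_measurable (PiM {..<n} (\<lambda>_. D))"
    by simp
  show ?case
    unfolding SUM_state_Suc Let_def by measurable
qed

section \<open>The random process and its shadow sequence\<close>

text \<open>The step size enters only through positivity and \<open>step\<close>; the concrete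
  minimum is treated when the locale is interpreted.\<close>

locale SUM_process = prob_space M for M :: "'w measure" +
  fixes f :: "'a::euclidean_space \<Rightarrow> real"
    and \<G> :: "'a \<Rightarrow> 'b \<Rightarrow> 'a"
    and D :: "'b measure"
    and \<xi> :: "nat \<Rightarrow> 'w \<Rightarrow> 'b"
    and L \<sigma> G \<alpha> \<beta> s :: real
    and x0 :: 'a
  assumes L_pos: "L > 0" and smooth: "L_smooth L f" and bdd_f: "bdd_below (range f)"
    and indep: "indep_vars (\<lambda>_. D) \<xi> UNIV"
    and law: "\<And>k. distr M D (\<xi> k) = D"
    and unbiased: "stochastic_gradient D \<G> f"
    and noise_int: "\<And>x. integrable D (\<lambda>z. (norm (\<G> x z - gradient f x))\<^sup>2)"
    and noise_var: "\<And>x. (LINT z|D. (norm (\<G> x z - gradient f x))\<^sup>2) \<le> \<sigma>\<^sup>2"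
    and grad_bound: "\<And>x. norm (gradient f x) \<le> G"
    and beta: "0 \<le> \<beta>" "\<beta> < 1" and alpha: "0 < \<alpha>"
    and step: "L * (\<alpha> / (1 - \<beta>)) * (1 + ((1 - \<beta>) * s - 1)\<^sup>2) \<le> 1"
begin

definition state :: "nat \<Rightarrow> 'w \<Rightarrow> 'a \<times> 'a" where
  "state k \<omega> = SUM_state \<alpha> \<beta> s \<G> x0 (\<lambda>i. \<xi> i \<omega>) k"

definition noise :: "nat \<Rightarrow> 'w \<Rightarrow> 'a" where
  "noise k \<omega> = \<G> (fst (state k \<omega>)) (\<xi> k \<omega>) - gradient f (fst (state k \<omega>))"

definition grad :: "nat \<Rightarrow> 'w \<Rightarrow> 'a" where
  "grad k \<omega> = gradient f (fst (state k \<omega>))"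

definition shadow :: "'a \<times> 'a \<Rightarrow> 'a" where
  "shadow p = fst p + (\<beta> / (1 - \<beta>)) *\<^sub>R (fst p - snd p)"

text \<open>Unfolds to the sum over \<open>i < k\<close> of \<open>\<beta> ^ (k - 1 - i)\<close>
  times the stochastic gradient at step \<open>i\<close>, split into its mean and its noise.\<close>

primrec accum :: "nat \<Rightarrow> 'w \<Rightarrow> 'a" where
  "accum 0 \<omega> = 0"
| "accum (Suc k) \<omega> = \<beta> *\<^sub>R accum k \<omega> + (grad k \<omega> + noise k \<omega>)"

lemma state_0 [simp]: "state 0 \<omega> = (x0, x0)"
  by (simp add: state_def)

lemma fst_state_Suc:
  "fst (state (Suc k) \<omega>) = fst (state k \<omega>) - \<alpha> *\<^sub>R (grad k \<omega> + noise k \<omega>)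
     + \<beta> *\<^sub>R (fst (state k \<omega>) - (s * \<alpha>) *\<^sub>R (grad k \<omega> + noise k \<omega>) - snd (state k \<omega>))"
  and snd_state_Suc:
  "snd (state (Suc k) \<omega>) = fst (state k \<omega>) - (s * \<alpha>) *\<^sub>R (grad k \<omega> + noise k \<omega>)"
  unfolding state_def SUM_state_Suc by (simp_all add: Let_def grad_def noise_def state_def)

text \<open>Both sides start at 0 and obey the same linear recursion: each step multiplies by
  \<open>\<beta>\<close> and adds the new stochastic gradient with coefficient
  \<open>s * \<alpha> - \<alpha> - \<beta> * s * \<alpha>\<close>.\<close>

lemma state_diff: "fst (state k \<omega>) - snd (state k \<omega>) = (((1 - \<beta>) * s - 1) * \<alpha>) *\<^sub>R accum k \<omega>"
proof (induction k)
  case (Suc k)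
  have "fst (state (Suc k) \<omega>) - snd (state (Suc k) \<omega>)
      = \<beta> *\<^sub>R (fst (state k \<omega>) - snd (state k \<omega>))
        + (((1 - \<beta>) * s - 1) * \<alpha>) *\<^sub>R (grad k \<omega> + noise k \<omega>)"
    unfolding fst_state_Suc snd_state_Suc by (simp add: algebra_simps)
  then show ?case
    unfolding Suc.IH by (simp add: algebra_simps)
qed simp

text \<open>Up to the factor \<open>1 - \<beta>\<close>, the shadow point is
  \<open>x - \<beta> * ys\<close>. In the new value of this combination the new \<open>ys\<close>
  cancels against the momentum term, leaving the old value minus \<open>\<alpha>\<close> times the
  stochastic gradient.\<close>

lemma shadow_Suc:
  "shadow (state (Suc k) \<omega>) = shadow (state k \<omega>) - (\<alpha> / (1 - \<beta>)) *\<^sub>R (grad k \<omega> + noise k \<omega>)"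
proof -
  have scaled: "(1 - \<beta>) *\<^sub>R shadow p = fst p - \<beta> *\<^sub>R snd p" for p
    using beta by (simp add: shadow_def scaleR_add_right) (simp add: algebra_simps)
  have "(1 - \<beta>) *\<^sub>R shadow (state (Suc k) \<omega>)
      = (1 - \<beta>) *\<^sub>R shadow (state k \<omega>) - \<alpha> *\<^sub>R (grad k \<omega> + noise k \<omega>)"
    unfolding scaled fst_state_Suc snd_state_Suc by (simp add: algebra_simps)
  also have "\<dots> = (1 - \<beta>) *\<^sub>R (shadow (state k \<omega>) - (\<alpha> / (1 - \<beta>)) *\<^sub>R (grad k \<omega> + noise k \<omega>))"
    using beta by (simp add: scaleR_diff_right)
  finally show ?thesis
    using beta by simp
qed

text \<open>The outer factor is the \<open>c\<close> of \<open>lagged_gradient_descent\<close> and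
  the remaining vector its \<open>r\<close>.\<close>

lemma shadow_lag:
  "shadow (state k \<omega>) - fst (state k \<omega>)
     = ((1 - \<beta>) * s - 1) *\<^sub>R ((\<alpha> * \<beta> / (1 - \<beta>)) *\<^sub>R accum k \<omega>)"
  by (simp add: shadow_def state_diff)

section \<open>Measurability and conditional mean of the noise\<close>

lemma stochastic_gradient_measurable: "(\<lambda>(x, z). \<G> x z) \<in> borel_measurable (borel \<Otimes>\<^sub>M D)"
  using unbiased by (simp add: stochastic_gradient_def)

lemma f_measurable [measurable]: "f \<in> borel_measurable borel"
  and gradient_measurable [measurable]: "gradient f \<in> borel_measurable borel"
  using L_smooth_measurable[OF smooth] by auto

lemma xi_measurable [measurable]: "\<xi> k \<in> measurable M D"
  using indep by (simp add: indep_vars_def)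

lemma state_as_past: "state k \<omega> = SUM_state \<alpha> \<beta> s \<G> x0 (restrict (\<lambda>i. \<xi> i \<omega>) {..<k}) k"
  unfolding state_def by (rule SUM_state_cong) simp

lemma state_measurable [measurable]: "state k \<in> measurable M (borel \<Otimes>\<^sub>M borel)"
proof -
  have "(\<lambda>\<omega>. restrict (\<lambda>i. \<xi> i \<omega>) {..<k}) \<in> measurable M (PiM {..<k} (\<lambda>_. D))"
    by (rule measurable_restrict) measurable
  from measurable_compose[OF this SUM_state_measurable[OF stochastic_gradient_measurable order_refl]]
  show ?thesis
    unfolding state_as_past[abs_def] .
qed

lemma joint_law:
  "distr M ((borel \<Otimes>\<^sub>M borel) \<Otimes>\<^sub>M D) (\<lambda>\<omega>. (state k \<omega>, \<xi> k \<omega>))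
     = distr M (borel \<Otimes>\<^sub>M borel) (state k) \<Otimes>\<^sub>M D"
  using distr_pair_past_present[OF indep SUM_state_measurable[OF stochastic_gradient_measurable order_refl]]
  unfolding law state_as_past[abs_def] .

lemma prob_space_D: "prob_space D"
  using prob_space_distr[OF xi_measurable[of 0]] law[of 0] by simp

text \<open>The kernel takes the whole state, not just the iterate, because it will be paired with
  functions of the shadow point, which depends on both components.\<close>

lemma noise_kernel_measurable:
  "(\<lambda>(p, z). \<G> (fst p) z - gradient f (fst p)) \<in> borel_measurable ((borel \<Otimes>\<^sub>M borel) \<Otimes>\<^sub>M D)"
proof -
  have "(\<lambda>q. (fst (fst q), snd q)) \<in> measurable ((borel \<Otimes>\<^sub>M borel) \<Otimes>\<^sub>M D) (borel \<Otimes>\<^sub>M D)"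
    by measurable
  from measurable_compose[OF this stochastic_gradient_measurable]
  have [measurable]: "(\<lambda>q. \<G> (fst (fst q)) (snd q)) \<in> borel_measurable ((borel \<Otimes>\<^sub>M borel) \<Otimes>\<^sub>M D)"
    by simp
  show ?thesis
    unfolding case_prod_beta by measurable
qed

lemma noise_kernel_integrable: "integrable D (\<lambda>z. \<G> x z - gradient f x)"
  and noise_kernel_mean: "(LINT z|D. \<G> x z - gradient f x) = 0"
proof -
  interpret D: prob_space D
    by (rule prob_space_D)
  have G: "integrable D (\<G> x)" "(LINT z|D. \<G> x z) = gradient f x"
    using unbiased by (auto simp: stochastic_gradient_def)
  then show "integrable D (\<lambda>z. \<G> x z - gradient f x)"
    by simp
  show "(LINT z|D. \<G> x z - gradient f x) = 0"
    using G by (simp add: D.prob_space)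
qed

text \<open>In order: integrability and bound of the squared noise, then integrability and vanishing
  mean of its inner product with a bounded measurable function of the state.\<close>

lemmas noise_facts = indep_noise[OF state_measurable xi_measurable law joint_law
    noise_kernel_measurable noise_kernel_mean noise_kernel_integrable noise_int noise_var,
    folded noise_def]

lemma noise_measurable [measurable]: "noise k \<in> borel_measurable M"
  using measurable_compose[OF measurable_Pair[OF state_measurable xi_measurable] noise_kernel_measurable]
  by (simp add: noise_def[abs_def])

lemma grad_measurable [measurable]: "grad k \<in> borel_measurable M"
  unfolding grad_def[abs_def] by measurable

lemma shadow_measurable [measurable]: "shadow \<in> borel_measurable (borel \<Otimes>\<^sub>M borel)"
  unfolding shadow_def[abs_def] by measurable

lemma accum_measurable [measurable]: "accum k \<in> borel_measurable M"
  by (induction k) simp_all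

section \<open>Second moments\<close>

lemma integrable_grad_square: "integrable M (\<lambda>\<omega>. (norm (grad k \<omega>))\<^sup>2)"
  by (rule integrable_const_bound[where B = "G\<^sup>2"]) (auto simp: grad_def grad_bound power_mono)

text \<open>The cross term pairs the noise with a bounded function of the state, so it has mean 0
  and the two second moments simply add.\<close>

lemma stochastic_gradient_second_moment:
  shows integrable_stochastic_gradient_square: "integrable M (\<lambda>\<omega>. (norm (grad k \<omega> + noise k \<omega>))\<^sup>2)"
    and stochastic_gradient_square_le: "expectation (\<lambda>\<omega>. (norm (grad k \<omega> + noise k \<omega>))\<^sup>2) \<le> G\<^sup>2 + \<sigma>\<^sup>2"
proof -
  have eq: "(norm (grad k \<omega> + noise k \<omega>))\<^sup>2
      = (norm (grad k \<omega>))\<^sup>2 + (norm (noise k \<omega>))\<^sup>2 + 2 * inner (gradient f (fst (state k \<omega>))) (noise k \<omega>)" for \<omega>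
    unfolding power2_norm_eq_inner grad_def by (simp add: algebra_simps inner_commute)
  have h: "(\<lambda>p. gradient f (fst p)) \<in> borel_measurable (borel \<Otimes>\<^sub>M (borel :: 'a measure))"
    by measurable
  have int: "integrable M (\<lambda>\<omega>. (norm (grad k \<omega>))\<^sup>2)" "integrable M (\<lambda>\<omega>. (norm (noise k \<omega>))\<^sup>2)"
    "integrable M (\<lambda>\<omega>. inner (gradient f (fst (state k \<omega>))) (noise k \<omega>))"
    by (rule integrable_grad_square noise_facts(1) noise_facts(3)[OF h grad_bound])+
  have "expectation (\<lambda>\<omega>. (norm (grad k \<omega>))\<^sup>2) \<le> G\<^sup>2"
    by (intro integral_le_const integrable_grad_square) (auto simp: grad_def grad_bound power_mono)
  then show "expectation (\<lambda>\<omega>. (norm (grad k \<omega> + noise k \<omega>))\<^sup>2) \<le> G\<^sup>2 + \<sigma>\<^sup>2"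
    unfolding eq using int noise_facts(2)[of k] noise_facts(4)[OF h grad_bound] by simp
  show "integrable M (\<lambda>\<omega>. (norm (grad k \<omega> + noise k \<omega>))\<^sup>2)"
    unfolding eq using int by simp
qed

text \<open>The bound is the fixed point of \<open>v \<mapsto> \<beta> * v + (G\<^sup>2 +
  \<sigma>\<^sup>2) / (1 - \<beta>)\<close>, the recursion given by
  \<open>norm_square_discounted_add\<close>. Integrability is carried along to make the expectations
  monotone.\<close>

lemma accum_second_moment:
  shows integrable_accum_square: "integrable M (\<lambda>\<omega>. (norm (accum k \<omega>))\<^sup>2)"
    and accum_square_le: "expectation (\<lambda>\<omega>. (norm (accum k \<omega>))\<^sup>2) \<le> (G\<^sup>2 + \<sigma>\<^sup>2) / (1 - \<beta>)\<^sup>2"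
proof (induction k)
  case (Suc k)
  let ?bound = "\<lambda>\<omega>. \<beta> * (norm (accum k \<omega>))\<^sup>2 + (norm (grad k \<omega> + noise k \<omega>))\<^sup>2 / (1 - \<beta>)"
  {
    case 1
    show ?case
    proof (rule Bochner_Integration.integrable_bound)
      show "integrable M ?bound"
        using Suc.IH(1) integrable_stochastic_gradient_square[of k] by simp
      show "AE \<omega> in M. norm ((norm (accum (Suc k) \<omega>))\<^sup>2) \<le> norm (?bound \<omega>)"
        using norm_square_discounted_add[OF beta] beta by (auto intro: order_trans)
    qed measurable
  }
  note int = this
  {
    case 2
    have "expectation (\<lambda>\<omega>. (norm (accum (Suc k) \<omega>))\<^sup>2) \<le> expectation ?bound"
      using int Suc.IH(1) integrable_stochastic_gradient_square[of k] norm_square_discounted_add[OF beta]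
      by (intro integral_mono) auto
    also have "\<dots> = \<beta> * expectation (\<lambda>\<omega>. (norm (accum k \<omega>))\<^sup>2)
        + expectation (\<lambda>\<omega>. (norm (grad k \<omega> + noise k \<omega>))\<^sup>2) / (1 - \<beta>)"
      using Suc.IH(1) integrable_stochastic_gradient_square[of k] by simp
    also have "\<dots> \<le> \<beta> * ((G\<^sup>2 + \<sigma>\<^sup>2) / (1 - \<beta>)\<^sup>2) + (G\<^sup>2 + \<sigma>\<^sup>2) / (1 - \<beta>)"
      using Suc.IH(2) stochastic_gradient_square_le beta by (intro add_mono mult_left_mono divide_right_mono) auto
    also have "\<dots> = (G\<^sup>2 + \<sigma>\<^sup>2) / (1 - \<beta>)\<^sup>2"
      using beta by (simp add: divide_simps) (simp add: power2_eq_square algebra_simps)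
    finally show ?case .
  }
qed auto

section \<open>Expected descent and telescoping\<close>

text \<open>The cost of one step: the first summand comes from the lag through the bound on
  \<open>accum\<close>, the second from the noise variance.\<close>

definition error :: real where
  "error = L / 2 * ((\<alpha> * \<beta> / (1 - \<beta>))\<^sup>2 * ((G\<^sup>2 + \<sigma>\<^sup>2) / (1 - \<beta>)\<^sup>2)) + L * (\<alpha> / (1 - \<beta>))\<^sup>2 / 2 * \<sigma>\<^sup>2"

text \<open>\<open>lagged_gradient_descent\<close> is integrated along the shadow sequence. Its
  linear noise term has a coefficient \<open>h\<close> that is a bounded function of the state, so
  it averages to 0.\<close>

lemma expected_descent:
  assumes int: "integrable M (\<lambda>\<omega>. f (shadow (state k \<omega>)))"
  shows integrable_f_shadow_Suc: "integrable M (\<lambda>\<omega>. f (shadow (state (Suc k) \<omega>)))"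
    and expectation_f_shadow_Suc: "expectation (\<lambda>\<omega>. f (shadow (state (Suc k) \<omega>)))
      \<le> expectation (\<lambda>\<omega>. f (shadow (state k \<omega>)))
        - \<alpha> / (1 - \<beta>) / 2 * expectation (\<lambda>\<omega>. (norm (grad k \<omega>))\<^sup>2) + error"
proof -
  define \<eta> where "\<eta> = \<alpha> / (1 - \<beta>)"
  define h where "h p = (L * \<eta>\<^sup>2) *\<^sub>R gradient f (fst p) - \<eta> *\<^sub>R gradient f (shadow p)" for p
  have "0 \<le> \<eta>"
    using alpha beta by (simp add: \<eta>_def)
  have h: "h \<in> borel_measurable (borel \<Otimes>\<^sub>M borel)"
    unfolding h_def[abs_def] by measurable
  have h_bound: "norm (h p) \<le> L * \<eta>\<^sup>2 * G + \<eta> * G" for p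
    unfolding h_def using L_pos \<open>0 \<le> \<eta>\<close>
    by (intro order_trans[OF norm_triangle_ineq4] add_mono) (auto intro!: mult_left_mono grad_bound)
  note inner_noise = noise_facts(3)[OF h h_bound, of k] noise_facts(4)[OF h h_bound, of k]
  let ?bound = "\<lambda>\<omega>. f (shadow (state k \<omega>)) - \<eta> / 2 * (norm (grad k \<omega>))\<^sup>2
      + L / 2 * ((\<alpha> * \<beta> / (1 - \<beta>))\<^sup>2 * (norm (accum k \<omega>))\<^sup>2)
      + L * \<eta>\<^sup>2 / 2 * (norm (noise k \<omega>))\<^sup>2 + inner (h (state k \<omega>)) (noise k \<omega>)"
  have descent: "f (shadow (state (Suc k) \<omega>)) \<le> ?bound \<omega>" for \<omega>
    using lagged_gradient_descent[OF smooth less_imp_le[OF L_pos] \<open>0 \<le> \<eta>\<close> step[folded \<eta>_def]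
        shadow_lag[of k \<omega>], of "noise k \<omega>"]
    unfolding shadow_Suc \<eta>_def[symmetric] grad_def[symmetric] h_def
    by (simp add: power_mult_distrib power_divide grad_def)
  have bound_int: "integrable M ?bound"
    using int integrable_grad_square[of k] integrable_accum_square[of k] noise_facts(1)[of k] inner_noise(1) by simp
  \<comment> \<open>The new value of \<open>f\<close> lies between its finite infimum and the
    integrable upper bound.\<close>
  show int': "integrable M (\<lambda>\<omega>. f (shadow (state (Suc k) \<omega>)))"
  proof (rule Bochner_Integration.integrable_bound)
    show "integrable M (\<lambda>\<omega>. \<bar>?bound \<omega>\<bar> + \<bar>INF x. f x\<bar>)"
      by (rule Bochner_Integration.integrable_add[OF integrable_abs[OF bound_int]]) simp
    have "(INF x. f x) \<le> f (shadow (state (Suc k) \<omega>))" for \<omega>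
      using bdd_f by (rule cINF_lower) simp
    then show "AE \<omega> in M. norm (f (shadow (state (Suc k) \<omega>))) \<le> norm (\<bar>?bound \<omega>\<bar> + \<bar>INF x. f x\<bar>)"
      using descent by (intro AE_I2) (smt (verit) real_norm_def)
  qed measurable
  have "expectation (\<lambda>\<omega>. f (shadow (state (Suc k) \<omega>))) \<le> expectation ?bound"
    using int' bound_int descent by (intro integral_mono)
  also have "\<dots> = expectation (\<lambda>\<omega>. f (shadow (state k \<omega>)))
      - \<eta> / 2 * expectation (\<lambda>\<omega>. (norm (grad k \<omega>))\<^sup>2)
      + L / 2 * ((\<alpha> * \<beta> / (1 - \<beta>))\<^sup>2 * expectation (\<lambda>\<omega>. (norm (accum k \<omega>))\<^sup>2))
      + L * \<eta>\<^sup>2 / 2 * expectation (\<lambda>\<omega>. (norm (noise k \<omega>))\<^sup>2)"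
    using int integrable_grad_square[of k] integrable_accum_square[of k] noise_facts(1)[of k] inner_noise by simp
  also have "\<dots> \<le> expectation (\<lambda>\<omega>. f (shadow (state k \<omega>)))
      - \<eta> / 2 * expectation (\<lambda>\<omega>. (norm (grad k \<omega>))\<^sup>2) + error"
  proof -
    have "L / 2 * ((\<alpha> * \<beta> / (1 - \<beta>))\<^sup>2 * expectation (\<lambda>\<omega>. (norm (accum k \<omega>))\<^sup>2))
        \<le> L / 2 * ((\<alpha> * \<beta> / (1 - \<beta>))\<^sup>2 * ((G\<^sup>2 + \<sigma>\<^sup>2) / (1 - \<beta>)\<^sup>2))"
      using L_pos by (intro mult_left_mono accum_square_le) auto
    moreover have "L * \<eta>\<^sup>2 / 2 * expectation (\<lambda>\<omega>. (norm (noise k \<omega>))\<^sup>2) \<le> L * \<eta>\<^sup>2 / 2 * \<sigma>\<^sup>2"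
      using L_pos by (intro mult_left_mono noise_facts(2)) auto
    ultimately show ?thesis
      unfolding error_def \<eta>_def[symmetric] by linarith
  qed
  finally show "expectation (\<lambda>\<omega>. f (shadow (state (Suc k) \<omega>)))
      \<le> expectation (\<lambda>\<omega>. f (shadow (state k \<omega>)))
        - \<alpha> / (1 - \<beta>) / 2 * expectation (\<lambda>\<omega>. (norm (grad k \<omega>))\<^sup>2) + error"
    unfolding \<eta>_def .
qed

text \<open>The descent inequalities telescope from the initial shadow point, which is
  \<open>x0\<close> since both state components start there, down to a value at least the
  infimum.\<close>

lemma sum_gradient_bound:
  "\<alpha> / (1 - \<beta>) / 2 * (\<Sum>k<n. expectation (\<lambda>\<omega>. (norm (grad k \<omega>))\<^sup>2))
     \<le> f x0 - (INF x. f x) + real n * error"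
proof -
  have int: "integrable M (\<lambda>\<omega>. f (shadow (state k \<omega>)))" for k
    by (induction k) (auto intro: integrable_f_shadow_Suc)
  have "expectation (\<lambda>\<omega>. f (shadow (state n \<omega>)))
      + \<alpha> / (1 - \<beta>) / 2 * (\<Sum>k<n. expectation (\<lambda>\<omega>. (norm (grad k \<omega>))\<^sup>2)) \<le> f x0 + real n * error"
  proof (induction n)
    case (Suc n)
    then show ?case
      using expectation_f_shadow_Suc[OF int, of n] by (simp add: algebra_simps)
  qed (simp add: shadow_def prob_space)
  moreover have "(INF x. f x) \<le> expectation (\<lambda>\<omega>. f (shadow (state n \<omega>)))"
    using bdd_f by (intro integral_ge_const int AE_I2 cINF_lower) auto
  ultimately show ?thesis
    by linarith
qed

lemma Min_gradient_bound:
  "(MIN k\<in>{0..t}. expectation (\<lambda>\<omega>. (norm (grad k \<omega>))\<^sup>2))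
     \<le> 2 * (f x0 - (INF x. f x)) * (1 - \<beta>) / (real t + 1) * (1 / \<alpha>)
       + \<alpha> * ((L * \<beta>\<^sup>2 * (G\<^sup>2 + \<sigma>\<^sup>2) + L * \<sigma>\<^sup>2 * (1 - \<beta>)\<^sup>2) / (1 - \<beta>) ^ 3)"
proof -
  define \<mu> where "\<mu> = (MIN k\<in>{0..t}. expectation (\<lambda>\<omega>. (norm (grad k \<omega>))\<^sup>2))"
  define n where "n = real t + 1"
  have "n > 0" and "1 - \<beta> > 0"
    using beta by (simp_all add: n_def)
  \<comment> \<open>The minimum is at most the average over the \<open>t + 1\<close>
    iterates.\<close>
  have "n * \<mu> = (\<Sum>k<Suc t. \<mu>)"
    by (simp add: n_def algebra_simps)
  also have "\<dots> \<le> (\<Sum>k<Suc t. expectation (\<lambda>\<omega>. (norm (grad k \<omega>))\<^sup>2))"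
    unfolding \<mu>_def by (intro sum_mono Min_le) auto
  finally have "\<alpha> / (1 - \<beta>) / 2 * (n * \<mu>)
      \<le> \<alpha> / (1 - \<beta>) / 2 * (\<Sum>k<Suc t. expectation (\<lambda>\<omega>. (norm (grad k \<omega>))\<^sup>2))"
    using alpha beta by (intro mult_left_mono) auto
  also have "\<dots> \<le> f x0 - (INF x. f x) + n * error"
    using sum_gradient_bound[of "Suc t"] by (simp add: n_def add.commute)
  finally have "\<mu> \<le> (f x0 - (INF x. f x) + n * error) / (\<alpha> / (1 - \<beta>) / 2 * n)"
    using alpha beta \<open>n > 0\<close> by (subst pos_le_divide_eq) (auto simp: mult_ac)
  also have "\<dots> = 2 * (f x0 - (INF x. f x)) * (1 - \<beta>) / n * (1 / \<alpha>) + 2 * (1 - \<beta>) / \<alpha> * error"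
    using alpha \<open>1 - \<beta> > 0\<close> \<open>n > 0\<close> by (simp add: field_simps)
  \<comment> \<open>\<open>error\<close> is quadratic in \<open>\<alpha>\<close>, so one factor
    survives the division.\<close>
  also have "2 * (1 - \<beta>) / \<alpha> * error
      = \<alpha> * ((L * \<beta>\<^sup>2 * (G\<^sup>2 + \<sigma>\<^sup>2) + L * \<sigma>\<^sup>2 * (1 - \<beta>)\<^sup>2) / (1 - \<beta>) ^ 3)"
  proof -
    \<comment> \<open>An atomic denominator keeps \<open>field_simps\<close> from expanding
      \<open>1 - \<beta>\<close>.\<close>
    define b where "b = 1 - \<beta>"
    have "b > 0" using \<open>1 - \<beta> > 0\<close> by (simp add: b_def)
    then show ?thesis
      unfolding error_def b_def[symmetric] using alpha
      by (simp add: field_simps power2_eq_square power3_eq_cube)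
  qed
  finally show ?thesis
    unfolding \<mu>_def n_def .
qed

end

section \<open>The explicit step size\<close>

theorem theorem4:
  fixes f :: "'a::euclidean_space \<Rightarrow> real"
    and \<G> :: "'a \<Rightarrow> 'b \<Rightarrow> 'a"
    and M :: "'w measure" and D :: "'b measure"
    and \<xi> :: "nat \<Rightarrow> 'w \<Rightarrow> 'b"
    and L \<sigma> G \<alpha> \<beta> s C :: real
    and t :: nat and x0 :: 'a
  assumes "L > 0" and "L_smooth L f" and "bdd_below (range f)"
    and "prob_space M"
    and "prob_space.indep_vars M (\<lambda>_. D) \<xi> UNIV"
    and "\<And>k. distr M D (\<xi> k) = D"
    and "stochastic_gradient D \<G> f"
    and "\<And>x. integrable D (\<lambda>z. (norm (\<G> x z - gradient f x))\<^sup>2)"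
    and "\<And>x. (LINT z|D. (norm (\<G> x z - gradient f x))\<^sup>2) \<le> \<sigma>\<^sup>2"
    and "\<And>x. norm (gradient f x) \<le> G"
    and "0 \<le> \<beta>" and "\<beta> < 1" and "s \<ge> 0" and "C > 0"
    and "\<alpha> = min ((1 - \<beta>) / (2 * L * (1 + ((1 - \<beta>) * s - 1)\<^sup>2))) (C / sqrt (real t + 1))"
  shows "(MIN k\<in>{0..t}. LINT \<omega>|M.
            (norm (gradient f (SUM_iterate \<alpha> \<beta> s \<G> x0 (\<lambda>i. \<xi> i \<omega>) k)))\<^sup>2)
       \<le> 2 * (f x0 - (INF x. f x)) * (1 - \<beta>) / (real t + 1)
            * max (2 * L * (1 + ((1 - \<beta>) * s - 1)\<^sup>2) / (1 - \<beta>)) (sqrt (real t + 1) / C)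
         + C / sqrt (real t + 1)
            * ((L * \<beta>\<^sup>2 * (G\<^sup>2 + \<sigma>\<^sup>2) + L * \<sigma>\<^sup>2 * (1 - \<beta>)\<^sup>2) / (1 - \<beta>) ^ 3)"
proof -
  \<comment> \<open>\<open>A\<close> and \<open>R\<close> are the reciprocals of the two candidate
    step sizes, so \<open>1 / \<alpha>\<close> is their maximum.\<close>
  define A where "A = 2 * L * (1 + ((1 - \<beta>) * s - 1)\<^sup>2) / (1 - \<beta>)"
  define R where "R = sqrt (real t + 1) / C"
  have "A > 0" and "R > 0"
    using assms by (auto simp: A_def R_def add_pos_nonneg)
  have \<alpha>: "\<alpha> = min (1 / A) (1 / R)"
    using assms by (simp add: A_def R_def)
  have "\<alpha> > 0" and inv_\<alpha>: "1 / \<alpha> = max A R"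
    using \<open>A > 0\<close> \<open>R > 0\<close> by (auto simp: \<alpha> min_def max_def divide_simps split: if_splits)
  have "\<alpha> \<le> C / sqrt (real t + 1)"
    by (simp add: \<alpha> R_def)
  \<comment> \<open>By the factor 2 in \<open>A\<close>, the left side of \<open>step\<close> is in
    fact at most 1/2.\<close>
  have "\<alpha> * A \<le> 1"
    using \<open>A > 0\<close> by (simp add: \<alpha> min_def divide_simps)
  moreover have "\<alpha> * A = 2 * (L * (\<alpha> / (1 - \<beta>)) * (1 + ((1 - \<beta>) * s - 1)\<^sup>2))"
    by (simp add: A_def)
  ultimately have step: "L * (\<alpha> / (1 - \<beta>)) * (1 + ((1 - \<beta>) * s - 1)\<^sup>2) \<le> 1"
    using \<open>\<alpha> > 0\<close> \<open>A > 0\<close> mult_pos_pos[of \<alpha> A] by linarith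
  interpret prob_space M by fact
  interpret SUM_process M f \<G> D \<xi> L \<sigma> G \<alpha> \<beta> s x0
    using assms \<open>\<alpha> > 0\<close> step by unfold_locales auto
  \<comment> \<open>The error term increases with \<open>\<alpha>\<close> and takes the bound
    \<open>C / sqrt (real t + 1)\<close>; the other term uses the exact value of
    \<open>1 / \<alpha>\<close>.\<close>
  have "\<alpha> * ((L * \<beta>\<^sup>2 * (G\<^sup>2 + \<sigma>\<^sup>2) + L * \<sigma>\<^sup>2 * (1 - \<beta>)\<^sup>2) / (1 - \<beta>) ^ 3)
      \<le> C / sqrt (real t + 1) * ((L * \<beta>\<^sup>2 * (G\<^sup>2 + \<sigma>\<^sup>2) + L * \<sigma>\<^sup>2 * (1 - \<beta>)\<^sup>2) / (1 - \<beta>) ^ 3)"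
    using \<open>\<alpha> \<le> C / sqrt (real t + 1)\<close> assms by (intro mult_right_mono) auto
  then show ?thesis
    using Min_gradient_bound[of t]
    unfolding grad_def state_def SUM_iterate_def[symmetric] inv_\<alpha> A_def R_def
    by linarith
qed

end
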